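(* Let $\lambda\in(0,1)$, let $k\ge2$ be an integer, and let $f$ be defined on $\mathbb{D}$ by $$\frac{z}{f(z)}=(1-z)\left(1-\frac{\lambda z}{k}\sum_{\nu=0}^{k-1}z^{\nu}\right)=1-z\left(1+\frac{\lambda}{k}\right)+\frac{\lambda z^{k+1}}{k}.$$ Then $f\in\mathcal{U}(\lambda)$, but $z/f(z)$ is not subordinate to $(1-z)(1-\lambda z)$.
   Context: $\mathbb{D}=\{z\in\mathbb{C}:|z|<1\}$. $\mathcal{A}$ is the family of analytic functions $f$ in $\mathbb{D}$ with $f(0)=0=f'(0)-1$. For $0<\lambda\le1$, $\mathcal{U}(\lambda)$ is the set of $f\in\mathcal{A}$ with $\left|\left(\frac{z}{f(z)}\right)^2f'(z)-1\right|<\lambda$ for all $z\in\mathbb{D}$ (in particular $f$ does not vanish in $\mathbb{D}\setminus\{0\}$, and $z/f(z)$ is understood to be $1$ at $z=0$). An analytic function $p$ in $\mathbb{D}$ is subordinate to an analytic function $q$ in $\mathbb{D}$ if there is an analytic function $\phi:\mathbb{D}\to\mathbb{D}$ with $\phi(0)=0$ and $p=q\circ\phi$ in $\mathbb{D}$. *)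

theory Defs
  imports "HOL-Analysis.Analysis"
begin

abbreviation unit_disc :: "complex set" ("\<D>")
  where "\<D> \<equiv> ball 0 1"

definition class_A :: "(complex \<Rightarrow> complex) set"
  where "class_A = {f. f analytic_on \<D> \<and> f 0 = 0 \<and> deriv f 0 = 1}"

text \<open>The function \<open>z / f(z)\<close>, with the convention that it takes the value \<open>1\<close> at the origin.\<close>

definition z_over :: "(complex \<Rightarrow> complex) \<Rightarrow> complex \<Rightarrow> complex"
  where "z_over f z = (if z = 0 then 1 else z / f z)"

text \<open>Non-vanishing off the origin is stated explicitly, so that membership does not depend on
  the value of a division by zero.\<close>

definition class_U :: "real \<Rightarrow> (complex \<Rightarrow> complex) set"
  where "class_U l = {f \<in> class_A. (\<forall>z \<in> \<D> - {0}. f z \<noteq> 0) \<and>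
           (\<forall>z \<in> \<D>. norm ((z_over f z)\<^sup>2 * deriv f z - 1) < l)}"

text \<open>Intended for \<open>p\<close> and \<open>q\<close> analytic in the disc. Analyticity is not part of the definition,
  so that the negation never holds merely because \<open>p\<close> or \<open>q\<close> fails to be analytic.\<close>

definition subordinate :: "(complex \<Rightarrow> complex) \<Rightarrow> (complex \<Rightarrow> complex) \<Rightarrow> bool"
  where "subordinate p q \<longleftrightarrow>
    (\<exists>\<phi>. \<phi> analytic_on \<D> \<and> \<phi> ` \<D> \<subseteq> \<D> \<and> \<phi> 0 = 0 \<and> (\<forall>z \<in> \<D>. p z = q (\<phi> z)))"

end

theory Submission
  imports Defs "HOL-Complex_Analysis.Complex_Analysis"
begin

text \<open>
  Write \<open>h = z/f\<close>. Then \<open>(z/f)\<^sup>2 f' - 1 = h - z h' - 1 = - \<lambda> z\<^sup>k\<^sup>+\<^sup>1\<close>, whence \<open>f \<in> \<U>(\<lambda>)\<close>.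
  If \<open>h = (1 - \<phi>)(1 - \<lambda>\<phi>)\<close> with a Schwarz function \<open>\<phi>\<close>, then \<open>\<phi>'(0) = a = (1 + \<lambda>/k)/(1 + \<lambda>) < 1\<close>,
  and the Schwarz--Pick lemma for \<open>\<phi>(z)/z\<close> gives \<open>1 - |\<phi>(x)| \<ge> (1 - x\<^sup>2)/(1 + a x)\<close> for \<open>0 < x < 1\<close>.
  Hence \<open>h(x)/(1 - x) \<ge> (1 - \<lambda>)(1 + x)/(1 + a x)\<close>. As \<open>x \<rightarrow> 1\<close> the left-hand side tends to \<open>1 - \<lambda>\<close>
  and the right-hand side to \<open>2(1 - \<lambda>)/(1 + a) > 1 - \<lambda>\<close>, a contradiction.
\<close>

text \<open>Following \<open>g\<close> by the disc automorphism that sends \<open>g 0\<close> to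
  \<open>0\<close> puts it within reach of the Schwarz lemma. The resulting bound on the
  pseudo-hyperbolic distance from \<open>g 0\<close> to \<open>g z\<close> is then weakened to one
  on moduli alone.\<close>

lemma Schwarz_Pick_origin:
  assumes holg: "g holomorphic_on ball 0 1"
    and g1: "\<And>z. norm z < 1 \<Longrightarrow> norm (g z) < 1"
    and z: "norm z < 1"
  shows "norm (g z) \<le> (norm z + norm (g 0)) / (1 + norm (g 0) * norm z)"
proof -
  define a b where "a = g 0" and "b = g z"
  have a: "norm a < 1" and b: "norm b < 1"
    using g1 z by (auto simp: a_def b_def)
  let ?m = "\<lambda>z. Moebius_function 0 a (g z)"
  have "norm (?m z) \<le> norm z"
  proof (rule Schwarz_Lemma(1))
    show "?m holomorphic_on ball 0 1"
      using holomorphic_on_compose_gen[OF holg Moebius_function_holomorphic[OF a], of 0] g1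
      by (force simp: o_def)
    show "?m 0 = 0" by (simp add: a_def Moebius_function_eq_zero)
    show "norm (?m w) < 1" if "norm w < 1" for w
      using Moebius_function_norm_lt_1 a g1 that by blast
  qed (use z in auto)
  moreover have ab: "norm a * norm b < 1"
    using a b by (metis norm_mult norm_mult_less mult_1)
  then have "cnj a * b \<noteq> 1"
    by (metis complex_mod_cnj less_irrefl norm_mult norm_one)
  then have "norm (1 - cnj a * b) > 0" by auto
  ultimately have le: "norm (b - a) \<le> norm z * norm (1 - cnj a * b)"
    by (simp add: Moebius_function_simple norm_divide field_simps b_def)
  \<comment> \<open>Squaring \<open>le\<close> and eliminating \<open>norm (b - a)\<close> by this
    identity leaves only \<open>norm (1 - cnj a * b)\<close>, which is bounded below by
    \<open>1 - norm a * norm b\<close>.\<close>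
  have id: "(norm (1 - cnj a * b))\<^sup>2 - (norm (b - a))\<^sup>2 = (1 - (norm a)\<^sup>2) * (1 - (norm b)\<^sup>2)"
    unfolding cmod_power2 by (simp add: power2_eq_square algebra_simps)
  have "1 - norm a * norm b \<le> norm (1 - cnj a * b)"
    by (metis complex_mod_cnj norm_mult norm_one norm_triangle_ineq2)
  then have "(1 - (norm z)\<^sup>2) * (1 - norm a * norm b)\<^sup>2 \<le> (1 - (norm z)\<^sup>2) * (norm (1 - cnj a * b))\<^sup>2"
    using ab z by (intro mult_left_mono power_mono) (auto simp: power_le_one)
  also have "\<dots> \<le> (1 - (norm a)\<^sup>2) * (1 - (norm b)\<^sup>2)"
    using power_mono[OF le norm_ge_zero, of 2] unfolding id[symmetric]
    by (simp add: power_mult_distrib algebra_simps)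
  \<comment> \<open>The identity \<open>id\<close>, now for the reals \<open>norm a\<close> and
    \<open>norm b\<close>, turns the product back into a difference of squares.\<close>
  finally have "(norm b - norm a)\<^sup>2 \<le> (norm z * (1 - norm a * norm b))\<^sup>2"
    by (simp add: power2_eq_square algebra_simps)
  then have "norm b - norm a \<le> norm z * (1 - norm a * norm b)"
    by (rule power2_le_imp_le) (use ab in simp)
  then have "norm b * (1 + norm a * norm z) \<le> norm z + norm a"
    by (simp add: algebra_simps)
  moreover have "1 + norm a * norm z > 0"
    by (simp add: add_pos_nonneg)
  ultimately show ?thesis
    by (simp add: a_def b_def pos_le_divide_eq)
qed

text \<open>The quotient \<phi>(z)/z extends to a holomorphic \<open>g\<close> with
  \<open>g 0 = deriv \<phi> 0\<close>, to which \<open>Schwarz_Pick_origin\<close> applies.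
  Assumption \<open>d\<close> rules out rotations, so \<open>g\<close> maps into the open
  disc.\<close>

lemma Schwarz_Lemma_deriv:
  assumes hol: "\<phi> holomorphic_on ball 0 1" and \<phi>0: "\<phi> 0 = 0"
    and \<phi>1: "\<And>z. norm z < 1 \<Longrightarrow> norm (\<phi> z) < 1"
    and d: "norm (deriv \<phi> 0) < 1" and z: "norm z < 1"
  shows "norm (\<phi> z) \<le> norm z * ((norm z + norm (deriv \<phi> 0)) / (1 + norm (deriv \<phi> 0) * norm z))"
proof -
  obtain g where g: "g holomorphic_on ball 0 1"
      "\<And>z. norm z < 1 \<Longrightarrow> \<phi> z = z * g z" "deriv \<phi> 0 = g 0"
    using Schwarz3[OF hol \<phi>0] by blast
  have "norm (g w) < 1" if w: "norm w < 1" for w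
  proof (cases "w = 0")
    case False
    \<comment> \<open>Equality in the Schwarz lemma would make \<phi> a rotation, whose derivative
      at the origin has modulus 1.\<close>
    have "norm (\<phi> w) \<noteq> norm w"
    proof
      assume "norm (\<phi> w) = norm w"
      then obtain \<alpha> where \<alpha>: "\<And>z. norm z < 1 \<Longrightarrow> \<phi> z = \<alpha> * z" "norm \<alpha> = 1"
        using Schwarz_Lemma(3)[OF hol \<phi>0 \<phi>1 w] w False by blast
      have "deriv \<phi> 0 = deriv (\<lambda>z. \<alpha> * z) 0"
        by (rule deriv_cong_ev)
           (use \<alpha>(1) in \<open>auto simp: eventually_nhds intro!: exI[of _ "ball 0 1"]\<close>)
      also have "\<dots> = \<alpha>" by simp
      finally show False using d \<alpha>(2) by simp
    qed
    then have "norm (\<phi> w) < norm w"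
      using Schwarz_Lemma(1)[OF hol \<phi>0 \<phi>1 w] by force
    then show ?thesis using g(2)[OF w] False by (simp add: norm_mult)
  qed (use d g(3) in simp)
  from Schwarz_Pick_origin[OF g(1) this z] show ?thesis
    using g(2)[OF z] g(3) by (simp only: norm_mult) (rule mult_left_mono, auto)
qed

theorem mainTheorem4:
  fixes l :: real and k :: nat and f :: "complex \<Rightarrow> complex"
  assumes "0 < l" and "l < 1"
    and "k \<ge> 2"
    and "f 0 = 0"
    and "\<forall>z \<in> \<D>. z_over f z =
           (1 - z) * (1 - of_real l * z / of_nat k * (\<Sum>\<nu> = 0..k - 1. z ^ \<nu>))"
  shows "(\<forall>z \<in> \<D>. z_over f z =
            1 - z * (1 + of_real l / of_nat k) + of_real l * z ^ (k + 1) / of_nat k) \<and>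
         f \<in> class_U l \<and>
         \<not> subordinate (z_over f) (\<lambda>z. (1 - z) * (1 - of_real l * z))"
proof -
  define h where "h z = 1 - z * (1 + of_real l / of_nat k) + of_real l * z ^ (k + 1) / of_nat k"
    for z :: complex
  define h' where "h' z = - (1 + of_real l / of_nat k) + of_real l * (of_nat (k + 1) * z ^ k) / of_nat k"
    for z :: complex
  define S where "S z = (\<Sum>\<nu> = 0..k - 1. z ^ \<nu>)" for z :: complex
  have k: "k > 0" using \<open>k \<ge> 2\<close> by simp
  have h_factor: "h z = (1 - z) * (1 - of_real l * z / of_nat k * S z)" for z
  proof -
    have "(1 - z) * S z = 1 - z ^ k"
      using sum_gp_basic[of z "k - 1"] k by (simp add: S_def atLeast0AtMost)
    then have "(1 - z) * (1 - of_real l * z / of_nat k * S z)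
        = (1 - z) - of_real l * z / of_nat k * (1 - z ^ k)"
      by (simp only: right_diff_distrib mult.left_commute[of "1 - z"] mult_1_right)
    then show ?thesis using k by (simp add: h_def field_simps)
  qed
  have zo: "z_over f z = h z" if "z \<in> \<D>" for z
    using assms(5) that h_factor[of z] by (simp add: S_def)
  have h_nz: "h z \<noteq> 0" if "z \<in> \<D>" for z
  proof -
    \<comment> \<open>\<open>S z\<close> has \<open>k\<close> terms of modulus at most 1, so the
      second factor of \<open>h z\<close> differs from 1 by at most \<open>l < 1\<close>.\<close>
    have "norm (S z) \<le> (\<Sum>\<nu> = 0..k - 1. 1)"
      unfolding S_def using that by (intro sum_norm_le) (auto simp: norm_power power_le_one)
    then have S: "norm (S z) \<le> k" using k by simp
    have "norm (of_real l * z / of_nat k * S z) = l * norm z * (norm (S z) / k)"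
      using \<open>0 < l\<close> by (simp add: norm_mult norm_divide)
    also have "\<dots> \<le> l * 1 * 1"
      using S that k \<open>0 < l\<close> by (intro mult_mono) auto
    finally have "of_real l * z / of_nat k * S z \<noteq> 1"
      using \<open>l < 1\<close> by force
    then show ?thesis using that by (auto simp: h_factor)
  qed
  have h_deriv: "(h has_field_derivative h' z) (at z)" for z
    unfolding h_def h'_def using k
    by (auto intro!: derivative_eq_intros simp: field_simps power_eq_if[of z k])
  \<comment> \<open>Inverting \<open>z / f z\<close> is safe even before
    \<open>f z \<noteq> 0\<close> is known, since \<open>x / 0 = 0\<close>; at the origin both sides
    vanish.\<close>
  have f_eq: "f z = z / h z" if "z \<in> \<D>" for z
    unfolding zo[OF that, symmetric] using \<open>f 0 = 0\<close> by (simp add: z_over_def)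
  have f_deriv: "(f has_field_derivative (h z - z * h' z) / (h z)\<^sup>2) (at z)" if "z \<in> \<D>" for z
  proof (rule has_field_derivative_transform_within_open[OF _ open_ball that])
    show "((\<lambda>z. z / h z) has_field_derivative (h z - z * h' z) / (h z)\<^sup>2) (at z)"
      using h_nz[OF that] by (auto intro!: derivative_eq_intros h_deriv simp: power2_eq_square)
  qed (simp add: f_eq)

  have "f \<in> class_U l"
  proof -
    have "f analytic_on \<D>"
      unfolding analytic_on_open[OF open_ball] holomorphic_on_open[OF open_ball]
      using f_deriv by blast
    moreover have "deriv f 0 = 1"
      using DERIV_imp_deriv[OF f_deriv[of 0]] by (simp add: h_def)
    moreover have "f z \<noteq> 0" if "z \<in> \<D> - {0}" for z
      using that h_nz[of z] by (simp add: f_eq)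
    moreover have "norm ((z_over f z)\<^sup>2 * deriv f z - 1) < l" if "z \<in> \<D>" for z
    proof -
      have "(z_over f z)\<^sup>2 * deriv f z = h z - z * h' z"
        using zo[OF that] h_nz[OF that] DERIV_imp_deriv[OF f_deriv[OF that]] by simp
      \<comment> \<open>The linear term of \<open>h\<close> cancels, and the top coefficient becomes
        \<open>l / k - l * (k + 1) / k = - l\<close>.\<close>
      also have "\<dots> = 1 - of_real l * z ^ (k + 1)"
        using k by (simp add: h_def h'_def field_simps)
      finally have "norm ((z_over f z)\<^sup>2 * deriv f z - 1) = l * norm z ^ (k + 1)"
        using \<open>0 < l\<close> by (simp add: norm_mult norm_power)
      moreover have "norm z ^ (k + 1) < 1"
        using that power_less_one_iff[of "norm z" "k + 1"] by simp
      ultimately show ?thesis using \<open>0 < l\<close> by simp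
    qed
    ultimately show ?thesis
      using \<open>f 0 = 0\<close> by (auto simp: class_U_def class_A_def)
  qed

  moreover have "\<not> subordinate (z_over f) (\<lambda>z. (1 - z) * (1 - of_real l * z))"
  proof
    assume "subordinate (z_over f) (\<lambda>z. (1 - z) * (1 - of_real l * z))"
    then obtain \<phi> where an: "\<phi> analytic_on \<D>" and im: "\<phi> ` \<D> \<subseteq> \<D>" and \<phi>0: "\<phi> 0 = 0"
      and eq: "\<And>z. z \<in> \<D> \<Longrightarrow> h z = (1 - \<phi> z) * (1 - of_real l * \<phi> z)"
      unfolding subordinate_def using zo by metis
    have hol: "\<phi> holomorphic_on \<D>" using an by (simp add: analytic_imp_holomorphic)
    have \<phi>1: "norm (\<phi> z) < 1" if "norm z < 1" for z
      using im that by fastforce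
    \<comment> \<open>This value is forced by comparing the linear coefficients of \<open>h\<close>
      and \<open>(1 - \<phi>) * (1 - l * \<phi>)\<close>. Here \<open>k \<ge> 2\<close> matters: it
      gives \<open>a < 1\<close>, whereas \<open>k = 1\<close> would give
      \<open>a = 1\<close>.\<close>
    define a where "a = (1 + l / k) / (1 + l)"
    have lk: "0 < l / k" "l / k < l"
      using \<open>0 < l\<close> \<open>k \<ge> 2\<close> by (auto simp: pos_divide_less_eq)
    have a: "0 < a" "a < 1"
      using \<open>0 < l\<close> lk unfolding a_def by (auto intro: add_pos_pos divide_pos_pos)
    have deriv_\<phi>: "deriv \<phi> 0 = of_real a"
    proof -
      have d: "(\<phi> has_field_derivative deriv \<phi> 0) (at 0)"
        using hol by (auto intro: holomorphic_derivI)
      have "((\<lambda>z. (1 - \<phi> z) * (1 - of_real l * \<phi> z)) has_field_derivative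
          - (1 + of_real l) * deriv \<phi> 0) (at 0)"
        by (auto intro!: derivative_eq_intros d simp: \<phi>0 algebra_simps)
      then have "(h has_field_derivative - (1 + of_real l) * deriv \<phi> 0) (at 0)"
        by (rule has_field_derivative_transform_within_open[of _ _ _ \<D>]) (auto simp: eq)
      then have "- (1 + of_real l) * deriv \<phi> 0 = h' 0"
        using h_deriv DERIV_unique by blast
      also have "\<dots> = - of_real (1 + l / k)"
        using k by (simp add: h'_def zero_power)
      finally have "(1 + of_real l) * deriv \<phi> 0 = of_real (1 + l / k)"
        by (simp only: mult_minus_left neg_equal_iff_equal)
      moreover have "(1 + of_real l :: complex) \<noteq> 0"
        using \<open>0 < l\<close> by (metis add_pos_pos less_irrefl of_real_1 of_real_add of_real_eq_0_iff zero_less_one)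
      ultimately show ?thesis
        by (simp add: a_def field_simps)
    qed
    let ?lhs = "\<lambda>x::real. 1 - l * x / k * (\<Sum>\<nu> = 0..k - 1. x ^ \<nu>)"
    let ?rhs = "\<lambda>x::real. (1 - l) * ((1 + x) / (1 + a * x))"
    have ineq: "?rhs x \<le> ?lhs x" if x: "0 < x" "x < 1" for x
    proof -
      have pos: "1 + a * x > 0" using a x by (simp add: add_pos_pos)
      have xD: "of_real x \<in> \<D>" using x by simp
      have "norm (\<phi> (of_real x)) \<le> x * ((x + a) / (1 + a * x))"
        using Schwarz_Lemma_deriv[OF hol \<phi>0 \<phi>1, of "of_real x"] deriv_\<phi> a x by simp
      \<comment> \<open>Since \<open>(1 + a * x) - x * (x + a) = 1 - x^2\<close>, a factor
        \<open>1 - x\<close> splits off; it later cancels against the one in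
        \<open>h\<close>.\<close>
      also have "\<dots> = 1 - (1 - x) * ((1 + x) / (1 + a * x))"
        using pos by (simp add: field_simps)
      finally have "(1 - x) * ((1 + x) / (1 + a * x)) \<le> 1 - norm (\<phi> (of_real x))"
        by simp
      also have "\<dots> \<le> norm (1 - \<phi> (of_real x))"
        by (metis norm_one norm_triangle_ineq2)
      finally have 1: "(1 - x) * ((1 + x) / (1 + a * x)) \<le> norm (1 - \<phi> (of_real x))" .
      have "1 - l \<le> 1 - norm (of_real l * \<phi> (of_real x))"
        using \<phi>1[of "of_real x"] x \<open>0 < l\<close> by (simp add: norm_mult mult_left_le)
      also have "\<dots> \<le> norm (1 - of_real l * \<phi> (of_real x))"
        by (metis norm_one norm_triangle_ineq2)
      finally have 2: "1 - l \<le> norm (1 - of_real l * \<phi> (of_real x))" .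
      have "(1 - x) * ?rhs x \<le> norm (h (of_real x))"
        using mult_mono[OF 1 2] \<open>l < 1\<close> eq[OF xD] by (simp add: norm_mult mult_ac)
      also have "h (of_real x) = of_real ((1 - x) * ?lhs x)"
        by (simp add: h_factor S_def)
      also have "norm \<dots> = (1 - x) * \<bar>?lhs x\<bar>"
        using x by (simp add: abs_mult del: of_real_mult)
      finally have "?rhs x \<le> \<bar>?lhs x\<bar>"
        by (rule mult_left_le_imp_le) (use x in simp)
      moreover have "?lhs x \<ge> 0"
      proof -
        have "(\<Sum>\<nu> = 0..k - 1. x ^ \<nu>) \<le> (\<Sum>\<nu> = 0..k - 1. 1)"
          using x by (intro sum_mono) (simp add: power_le_one)
        then have "(\<Sum>\<nu> = 0..k - 1. x ^ \<nu>) / k \<le> 1" using k by simp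
        then have "(l * x) * ((\<Sum>\<nu> = 0..k - 1. x ^ \<nu>) / k) \<le> 1 * 1"
          using x \<open>0 < l\<close> \<open>l < 1\<close> by (intro mult_mono) (auto simp: mult_le_one sum_nonneg)
        then show ?thesis by simp
      qed
      ultimately show ?thesis by simp
    qed
    have "(?lhs \<longlongrightarrow> 1 - l * 1 / k * (\<Sum>\<nu> = 0..k - 1. 1 ^ \<nu>)) (at_left 1)"
      using k by (intro tendsto_intros) auto
    moreover have "(?rhs \<longlongrightarrow> (1 - l) * ((1 + 1) / (1 + a * 1))) (at_left 1)"
      using a by (intro tendsto_intros) auto
    moreover have "eventually (\<lambda>x. ?rhs x \<le> ?lhs x) (at_left 1)"
      by (rule eventually_mono[OF eventually_at_left_real[OF zero_less_one]], rule ineq) simp_all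
    ultimately have "(1 - l) * ((1 + 1) / (1 + a * 1)) \<le> 1 - l * 1 / k * (\<Sum>\<nu> = 0..k - 1. 1 ^ \<nu>)"
      by (intro tendsto_le[of "at_left (1::real)" ?lhs _ ?rhs]) (auto simp: trivial_limit_at_left_real)
    also have "\<dots> = (1 - l) * 1" using k by simp
    \<comment> \<open>Cancelling \<open>1 - l > 0\<close> leaves an inequality that would require
      \<open>a \<ge> 1\<close>.\<close>
    finally have "(1 + 1) / (1 + a * 1) \<le> 1"
      by (rule mult_left_le_imp_le) (use \<open>l < 1\<close> in simp)
    then show False using a by (simp add: field_simps)
  qed
  ultimately show ?thesis using zo unfolding h_def by blast
qed

end
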